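(* Let $\alpha\in(0,\tfrac12]$, $s=s_n=n^{1-\alpha}$, let $\lambda=\lambda_n\in[1,n]$ and $A=A_n>0$ be arbitrary sequences, and let $r$ be a fixed real number. Put $C_{\mathrm{dense}}(\alpha)=\tfrac12-\alpha$. Consider testing $H_0:\boldsymbol\beta=\mathbf 0$ against $H_1:\boldsymbol\beta\in\Xi(s_n,A_n)$ on the basis of $\mathbf Y\sim\mathbb P_{\boldsymbol\beta,\lambda}$. (i) If $r<C_{\mathrm{dense}}(\alpha)$ and $\tanh(A)\ge \dfrac{n^{-r}}{\sqrt{\lambda}}$ for all $n$, then the Total Degree Test is asymptotically powerful; that is, there is a sequence of thresholds $K_n$ such that the tests which reject if and only if $\sum_{i=1}^n d_i-\frac{\lambda(n-1)}{2}>K_n$ are asymptotically powerful against $\Xi(s_n,A_n)$. (ii) If $r>C_{\mathrm{dense}}(\alpha)$ and $\tanh(A)\le \dfrac{n^{-r}}{\sqrt{\lambda}}$ for all $n$, then all tests are asymptotically powerless, i.e. every sequence of tests $T_n$ is asymptotically powerless against $\Xi(s_n,A_n)$.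
   Context: Model. For $\boldsymbol\beta\in\mathbb R^n$ and $\lambda\in[1,n]$ (known, allowed to depend on $n$), $\mathbb P_{\boldsymbol\beta,\lambda}$ is the law of the symmetric adjacency matrix $\mathbf Y=(Y_{ij})_{1\le i,j\le n}$ with $Y_{ii}=0$, $Y_{ij}=Y_{ji}$, and $(Y_{ij})_{i<j}$ independent Bernoulli variables with success probabilities $p_{ij}=\frac{\lambda}{n}\frac{e^{\beta_i+\beta_j}}{1+e^{\beta_i+\beta_j}}$. The degree of vertex $i$ is $d_i=\sum_{j\ne i}Y_{ij}$. Parameter space. $\Xi(s,A)=\{\boldsymbol\beta\in[0,\infty)^n: |S(\boldsymbol\beta)|=s,\ \beta_i\ge A \text{ for } i\in S(\boldsymbol\beta)\}$, where $S(\boldsymbol\beta)=\{i:\beta_i\ne0\}$. Here $s_n=n^{1-\alpha}$ is understood as an integer. Tests. A test $T_n$ is a measurable $\{0,1\}$-valued function of $\mathbf Y$ (value $1$ means rejecting $H_0$); it may depend on $n,\lambda,s_n,A_n$. Its risk is $\mathrm{Risk}_n(T_n,\Xi(s_n,A_n))=\mathbb P_{\mathbf 0,\lambda}(T_n=1)+\sup_{\boldsymbol\beta\in\Xi(s_n,A_n)}\mathbb P_{\boldsymbol\beta,\lambda}(T_n=0)$. A sequence $T_n$ is asymptotically powerful if $\limsup_{n\to\infty}\mathrm{Risk}_n(T_n,\Xi(s_n,A_n))=0$, and asymptotically powerless if $\liminf_{n\to\infty}\mathrm{Risk}_n(T_n,\Xi(s_n,A_n))\ge1$. *)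

theory Defs
  imports "HOL-Probability.Probability"
begin

text \<open>
  Vertices are the numbers \<open>1, \<dots>, n\<close>. A parameter vector in \<open>\<real>\<^sup>n\<close> is a function on \<open>nat\<close> of
  which only the values on \<open>{1..n}\<close> matter; likewise for adjacency matrices.
\<close>

definition edge_prob :: "nat \<Rightarrow> real \<Rightarrow> (nat \<Rightarrow> real) \<Rightarrow> nat \<Rightarrow> nat \<Rightarrow> real" where
  "edge_prob n lam \<beta> i j = lam / real n * (exp (\<beta> i + \<beta> j) / (1 + exp (\<beta> i + \<beta> j)))"

definition adjacency_matrix :: "(nat \<times> nat \<Rightarrow> bool) \<Rightarrow> nat \<Rightarrow> nat \<Rightarrow> nat" where
  "adjacency_matrix X i j = (if i = j then 0 else of_bool (X (min i j, max i j)))"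

text \<open>
  The law of the adjacency matrix. It is a discrete distribution with finite support, so every
  function of the matrix is measurable. The argument \<^term>\<open>False\<close> makes all entries outside
  \<open>{1..n} \<times> {1..n}\<close> equal to 0.
\<close>

definition graph_law :: "nat \<Rightarrow> real \<Rightarrow> (nat \<Rightarrow> real) \<Rightarrow> (nat \<Rightarrow> nat \<Rightarrow> nat) pmf" where
  "graph_law n lam \<beta> =
     map_pmf adjacency_matrix
       (Pi_pmf {(i, j). 1 \<le> i \<and> i < j \<and> j \<le> n} False
          (\<lambda>(i, j). bernoulli_pmf (edge_prob n lam \<beta> i j)))"

definition vertex_degree :: "nat \<Rightarrow> (nat \<Rightarrow> nat \<Rightarrow> nat) \<Rightarrow> nat \<Rightarrow> nat" where
  "vertex_degree n Y i = (\<Sum>j \<in> {1..n} - {i}. Y i j)"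

definition beta_support :: "nat \<Rightarrow> (nat \<Rightarrow> real) \<Rightarrow> nat set" where
  "beta_support n \<beta> = {i \<in> {1..n}. \<beta> i \<noteq> 0}"

definition Xi :: "nat \<Rightarrow> nat \<Rightarrow> real \<Rightarrow> (nat \<Rightarrow> real) set" where
  "Xi n s A =
     {\<beta> \<in> {1..n} \<rightarrow>\<^sub>E {0..}. card (beta_support n \<beta>) = s \<and> (\<forall>i \<in> beta_support n \<beta>. \<beta> i \<ge> A)}"

text \<open>A test is a predicate on adjacency matrices; \<^term>\<open>True\<close> means rejecting the null hypothesis.\<close>

definition risk ::
  "nat \<Rightarrow> real \<Rightarrow> (nat \<Rightarrow> real) set \<Rightarrow> ((nat \<Rightarrow> nat \<Rightarrow> nat) \<Rightarrow> bool) \<Rightarrow> real" where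
  "risk n lam B T =
     measure_pmf.prob (graph_law n lam (\<lambda>_. 0)) {Y. T Y}
     + (SUP \<beta> \<in> B. measure_pmf.prob (graph_law n lam \<beta>) {Y. \<not> T Y})"

definition asymptotically_powerful ::
  "(nat \<Rightarrow> real) \<Rightarrow> (nat \<Rightarrow> (nat \<Rightarrow> real) set) \<Rightarrow> (nat \<Rightarrow> (nat \<Rightarrow> nat \<Rightarrow> nat) \<Rightarrow> bool) \<Rightarrow> bool" where
  "asymptotically_powerful lam B T \<longleftrightarrow> limsup (\<lambda>n. ereal (risk n (lam n) (B n) (T n))) = 0"

definition asymptotically_powerless ::
  "(nat \<Rightarrow> real) \<Rightarrow> (nat \<Rightarrow> (nat \<Rightarrow> real) set) \<Rightarrow> (nat \<Rightarrow> (nat \<Rightarrow> nat \<Rightarrow> nat) \<Rightarrow> bool) \<Rightarrow> bool" where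
  "asymptotically_powerless lam B T \<longleftrightarrow> liminf (\<lambda>n. ereal (risk n (lam n) (B n) (T n))) \<ge> 1"

definition total_degree_test :: "nat \<Rightarrow> real \<Rightarrow> real \<Rightarrow> (nat \<Rightarrow> nat \<Rightarrow> nat) \<Rightarrow> bool" where
  "total_degree_test n lam K Y \<longleftrightarrow>
     real (\<Sum>i = 1..n. vertex_degree n Y i) - lam * (real n - 1) / 2 > K"

definition C_dense :: "real \<Rightarrow> real" where
  "C_dense \<alpha> = 1 / 2 - \<alpha>"

end

theory Submission imports Defs begin

text \<open>
  For the upper bound, the total degree is twice a sum of independent Bernoulli variables of total
  variance at most \<open>n\<lambda>\<close>, while under the alternative its mean is shifted by at least a constant times
  \<open>s \<lambda> tanh A\<close>; Chebyshev's inequality with a threshold at half the shift suffices.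

  For the lower bound, the supremum over alternatives is replaced by the average over a prior, and
  the second moment of the mixture likelihood ratio \<open>L\<close> is shown to tend to 1. The prior cuts the
  vertices into \<open>s\<close> consecutive blocks of size \<open>m = n div s\<close>, picks one vertex uniformly and
  independently in each block and puts \<open>\<beta> = A\<close> there. With this prior the overlap of two independent
  draws is a sum of \<open>s\<close> independent indicators of mean \<open>1/m\<close> (for a uniform \<open>s\<close>-subset it would be
  hypergeometric), so that, with \<open>\<theta> = n powr (- 2 r)\<close>,
  \<open>E L\<^sup>2 \<le> exp (\<theta> s\<^sup>2 / n) (1 + (exp \<theta> - 1) / m) ^ s \<le> exp (5 \<theta> s\<^sup>2 / n)\<close>.
\<close>

section \<open>Second-moment bound for testing against a uniform mixture\<close>

text \<open>Averaging over \<open>F\<close> turns the second kind of error into that of the mixture,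
  whose likelihood ratio is \<open>L\<close>. Since \<open>E L = 1\<close>, the sum of the two
  errors is at least \<open>1 - E \<bar>L - 1\<bar>\<close>, and the first absolute moment is at
  most the standard deviation of \<open>L\<close>. The number \<open>b\<close> is left free so that
  a supremum over a larger parameter set can take its place.\<close>

lemma mixture_risk_bound:
  fixes P :: "'a pmf" and Q :: "'f \<Rightarrow> 'a pmf" and w :: "'f \<Rightarrow> 'a \<Rightarrow> real"
  assumes fin: "finite F" "F \<noteq> {}" "finite (set_pmf P)"
    and w: "\<And>f x. f \<in> F \<Longrightarrow> pmf (Q f) x = pmf P x * w f x"
    and second: "(\<Sum>f\<in>F. \<Sum>g\<in>F. measure_pmf.expectation P (\<lambda>x. w f x * w g x)) \<le> (1 + c) * (real (card F))\<^sup>2"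
    and b: "\<And>f. f \<in> F \<Longrightarrow> measure_pmf.prob (Q f) (- R) \<le> b"
  shows "1 - sqrt c \<le> measure_pmf.prob P R + b"
proof -
  note int = integrable_measure_pmf_finite[OF fin(3)]
  define N where "N = real (card F)"
  have N: "N > 0" using fin by (simp add: N_def card_gt_0_iff)
  define L where "L x = (\<Sum>f\<in>F. w f x) / N" for x
  have prob_Q: "measure_pmf.prob (Q f) S = measure_pmf.expectation P (\<lambda>x. w f x * indicator S x)"
    if f: "f \<in> F" for f S
  proof -
    \<comment> \<open>Absolute continuity: it allows the sum for \<open>Q f\<close> to run over the
      finite support of \<open>P\<close>.\<close>
    have sub: "set_pmf (Q f) \<subseteq> set_pmf P"
      using w[OF f] by (auto simp: set_pmf_eq)
    have "measure_pmf.prob (Q f) S = measure_pmf.expectation (Q f) (indicator S)"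
      by simp
    also have "\<dots> = (\<Sum>x\<in>set_pmf P. indicator S x * pmf (Q f) x)"
      using sub fin by (intro integral_measure_pmf_real) auto
    also have "\<dots> = (\<Sum>x\<in>set_pmf P. (w f x * indicator S x) * pmf P x)"
      by (simp add: w[OF f] mult_ac)
    also have "\<dots> = measure_pmf.expectation P (\<lambda>x. w f x * indicator S x)"
      using fin by (intro integral_measure_pmf_real[symmetric]) auto
    finally show ?thesis .
  qed
  have avg: "measure_pmf.expectation P (\<lambda>x. L x * indicator S x) = (\<Sum>f\<in>F. measure_pmf.prob (Q f) S) / N" for S
    by (simp add: L_def sum_distrib_right prob_Q int sum_divide_distrib)
  have EL: "measure_pmf.expectation P L = 1"
    using avg[of UNIV] N by (simp add: N_def)
  have "measure_pmf.expectation P (\<lambda>x. (L x)\<^sup>2) =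
      (\<Sum>f\<in>F. \<Sum>g\<in>F. measure_pmf.expectation P (\<lambda>x. w f x * w g x)) / N\<^sup>2"
    by (simp add: L_def power2_eq_square sum_product int sum_divide_distrib)
  also have "\<dots> \<le> 1 + c"
    using second N by (simp add: N_def divide_le_eq)
  finally have EL2: "measure_pmf.expectation P (\<lambda>x. (L x)\<^sup>2) \<le> 1 + c" .
  define U where "U x = \<bar>L x - 1\<bar>" for x
  \<comment> \<open>The bound on \<open>u\<close> below is Cauchy-Schwarz, derived from the
    nonnegativity of the variance of \<open>U\<close>.\<close>
  define u where "u = measure_pmf.expectation P U"
  have "u\<^sup>2 = measure_pmf.expectation P (\<lambda>x. (U x)\<^sup>2) - measure_pmf.expectation P (\<lambda>x. (U x - u)\<^sup>2)"
    by (simp add: power2_diff int u_def) (simp add: power2_eq_square algebra_simps)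
  also have "\<dots> \<le> measure_pmf.expectation P (\<lambda>x. (U x)\<^sup>2)"
    by (simp add: integral_nonneg_AE)
  also have "\<dots> = measure_pmf.expectation P (\<lambda>x. (L x)\<^sup>2) - 1"
    by (simp add: U_def power2_diff int EL)
  also have "\<dots> \<le> c" using EL2 by simp
  finally have u: "u \<le> sqrt c" by (rule real_le_rsqrt)
  \<comment> \<open>Pointwise, \<open>1 - \<bar>L x - 1\<bar>\<close> is at most both
    \<open>1\<close> and \<open>L x\<close>; the former is used on \<open>R\<close>, the latter off
    \<open>R\<close>.\<close>
  have "1 - u = measure_pmf.expectation P (\<lambda>x. 1 - U x)"
    by (simp add: u_def int)
  also have "\<dots> \<le> measure_pmf.expectation P (\<lambda>x. indicator R x + L x * indicator (- R) x)"
    by (intro integral_mono int) (auto simp: U_def indicator_def)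
  also have "\<dots> = measure_pmf.prob P R + (\<Sum>f\<in>F. measure_pmf.prob (Q f) (- R)) / N"
    by (simp add: int avg)
  also have "(\<Sum>f\<in>F. measure_pmf.prob (Q f) (- R)) / N \<le> b"
    using sum_mono[of F "\<lambda>f. measure_pmf.prob (Q f) (- R)" "\<lambda>_. b"] b N
    by (simp add: N_def divide_le_eq mult.commute)
  finally show ?thesis using u by simp
qed

section \<open>Variance and likelihood ratios of products of Bernoulli laws\<close>

text \<open>Expanding the square leaves only the diagonal, because independence and centering kill
  the cross terms.\<close>

lemma second_moment_sum_Pi_pmf:
  fixes g :: "'i \<Rightarrow> 'b \<Rightarrow> real"
  assumes I: "finite I" and p: "\<And>i. i \<in> I \<Longrightarrow> finite (set_pmf (p i))"
    and centered: "\<And>i. i \<in> I \<Longrightarrow> measure_pmf.expectation (p i) (g i) = 0"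
  shows "measure_pmf.expectation (Pi_pmf I d p) (\<lambda>X. (\<Sum>i\<in>I. g i (X i))\<^sup>2) =
         (\<Sum>i\<in>I. measure_pmf.expectation (p i) (\<lambda>v. (g i v)\<^sup>2))"
proof -
  let ?P = "Pi_pmf I d p"
  have "finite (set_pmf ?P)"
    using I p by (simp add: set_Pi_pmf finite_PiE_dflt)
  note int = integrable_measure_pmf_finite[OF this]
  have component: "measure_pmf.expectation ?P (\<lambda>X. h (X i)) = measure_pmf.expectation (p i) h"
    if "i \<in> I" for i and h :: "'b \<Rightarrow> real"
    using Pi_pmf_component[OF I, of i d p] that by (metis integral_map_pmf)
  have indep: "prob_space.indep_vars (measure_pmf ?P) (\<lambda>_. borel) (\<lambda>i X. g i (X i)) I"
    by (rule prob_space.indep_vars_compose2[OF prob_space_measure_pmf indep_vars_Pi_pmf[OF I]]) simp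
  have cross: "measure_pmf.expectation ?P (\<lambda>X. g i (X i) * g j (X j)) = 0"
    if ij: "i \<in> I" "j \<in> I" "i \<noteq> j" for i j
  proof -
    have "measure_pmf.expectation ?P (\<lambda>X. \<Prod>k\<in>{i, j}. g k (X k)) =
        (\<Prod>k\<in>{i, j}. measure_pmf.expectation ?P (\<lambda>X. g k (X k)))"
      by (rule prob_space.indep_vars_lebesgue_integral[OF prob_space_measure_pmf])
        (use ij int in \<open>auto intro: prob_space.indep_vars_subset[OF prob_space_measure_pmf indep]\<close>)
    also have "\<dots> = 0"
      using ij by (simp add: component centered)
    finally show ?thesis using ij by simp
  qed
  have "measure_pmf.expectation ?P (\<lambda>X. (\<Sum>i\<in>I. g i (X i))\<^sup>2) =
      (\<Sum>i\<in>I. \<Sum>j\<in>I. measure_pmf.expectation ?P (\<lambda>X. g i (X i) * g j (X j)))"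
    by (simp add: power2_eq_square sum_product int)
  also have "\<dots> = (\<Sum>i\<in>I. \<Sum>j\<in>I. if j = i then measure_pmf.expectation (p i) (\<lambda>v. (g i v)\<^sup>2) else 0)"
    by (intro sum.cong refl) (use cross component in \<open>auto simp: power2_eq_square\<close>)
  finally show ?thesis using I by simp
qed

text \<open>Chebyshev's inequality, with each variance \<open>q i * (1 - q i)\<close> bounded by
  \<open>q i\<close>. Allowing any subset \<open>E\<close> of the two-sided deviation event covers
  both one-sided errors of a threshold test.\<close>

lemma bernoulli_Pi_pmf_deviation:
  assumes I: "finite I" and q: "\<And>i. i \<in> I \<Longrightarrow> 0 \<le> q i \<and> q i \<le> 1" and a: "a > 0"
    and E: "E \<subseteq> {X. \<bar>(\<Sum>i\<in>I. of_bool (X i)) - sum q I\<bar> \<ge> a}"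
  shows "measure_pmf.prob (Pi_pmf I d (\<lambda>i. bernoulli_pmf (q i))) E \<le> sum q I / a\<^sup>2"
proof -
  let ?P = "Pi_pmf I d (\<lambda>i. bernoulli_pmf (q i))"
  define Z where "Z X = (\<Sum>i\<in>I. of_bool (X i) - q i)" for X
  have "finite (set_pmf ?P)"
    using I by (simp add: set_Pi_pmf finite_PiE_dflt)
  note int = integrable_measure_pmf_finite[OF this]
  have "measure_pmf.prob ?P E = measure_pmf.expectation ?P (indicator E)"
    by simp
  also have "\<dots> \<le> measure_pmf.expectation ?P (\<lambda>X. (Z X)\<^sup>2 / a\<^sup>2)"
  proof (intro integral_mono int)
    fix X
    have "1 \<le> (Z X)\<^sup>2 / a\<^sup>2" if "X \<in> E"
    proof -
      have "\<bar>a\<bar> \<le> \<bar>Z X\<bar>" using that E a by (auto simp: Z_def sum_subtractf)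
      then show ?thesis using a by (simp flip: abs_le_square_iff)
    qed
    then show "indicator E X \<le> (Z X)\<^sup>2 / a\<^sup>2" by (simp add: indicator_def)
  qed
  also have "\<dots> = (\<Sum>i\<in>I. measure_pmf.expectation (bernoulli_pmf (q i)) (\<lambda>v. (of_bool v - q i)\<^sup>2)) / a\<^sup>2"
    unfolding Z_def integral_divide_zero
    by (subst second_moment_sum_Pi_pmf[OF I]) (use q in auto)
  also have "\<dots> \<le> sum q I / a\<^sup>2"
  proof (intro divide_right_mono sum_mono)
    fix i assume i: "i \<in> I"
    have "measure_pmf.expectation (bernoulli_pmf (q i)) (\<lambda>v. (of_bool v - q i)\<^sup>2) = q i - (q i)\<^sup>2"
      using q[OF i] by (simp add: power2_eq_square algebra_simps)
    then show "measure_pmf.expectation (bernoulli_pmf (q i)) (\<lambda>v. (of_bool v - q i)\<^sup>2) \<le> q i"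
      by simp
  qed simp
  finally show ?thesis .
qed

text \<open>Independence reduces the mixed second moment of two likelihood ratios to one coordinate,
  where it equals 1 plus the chi-square inner product of the two perturbations of
  \<open>p i\<close>.\<close>

lemma bernoulli_Pi_pmf_likelihood_ratio:
  assumes I: "finite I" and p: "\<And>i. i \<in> I \<Longrightarrow> 0 < p i \<and> p i < 1"
  defines "w \<equiv> \<lambda>q X. \<Prod>i\<in>I. pmf (bernoulli_pmf (q i)) (X i) / pmf (bernoulli_pmf (p i)) (X i)"
  shows "pmf (Pi_pmf I d (\<lambda>i. bernoulli_pmf (q i))) X =
           pmf (Pi_pmf I d (\<lambda>i. bernoulli_pmf (p i))) X * w q X"
    and "\<lbrakk>\<And>i. i \<in> I \<Longrightarrow> 0 \<le> q i \<and> q i \<le> 1; \<And>i. i \<in> I \<Longrightarrow> 0 \<le> q' i \<and> q' i \<le> 1\<rbrakk> \<Longrightarrow>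
      measure_pmf.expectation (Pi_pmf I d (\<lambda>i. bernoulli_pmf (p i))) (\<lambda>X. w q X * w q' X) =
        (\<Prod>i\<in>I. 1 + (q i - p i) * (q' i - p i) / (p i * (1 - p i)))"
proof -
  have pos: "pmf (bernoulli_pmf (p i)) v > 0" if "i \<in> I" for i v
    using p[OF that] by (cases v) auto
  then have nz: "pmf (bernoulli_pmf (p i)) v \<noteq> 0" if "i \<in> I" for i v
    using that by (metis less_irrefl)
  show "pmf (Pi_pmf I d (\<lambda>i. bernoulli_pmf (q i))) X =
           pmf (Pi_pmf I d (\<lambda>i. bernoulli_pmf (p i))) X * w q X"
  proof (cases "\<forall>i. i \<notin> I \<longrightarrow> X i = d")
    case True
    moreover have "(\<Prod>i\<in>I. pmf (bernoulli_pmf (p i)) (X i)) \<noteq> 0"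
      using I nz by simp
    ultimately show ?thesis
      using I by (simp add: pmf_Pi w_def prod_dividef)
  next
    \<comment> \<open>A configuration that differs from \<open>d\<close> somewhere off
      \<open>I\<close> has mass 0 under both laws.\<close>
    case False
    then show ?thesis using I by (simp only: pmf_Pi if_False mult_zero_left)
  qed
  assume q: "\<And>i. i \<in> I \<Longrightarrow> 0 \<le> q i \<and> q i \<le> 1" and q': "\<And>i. i \<in> I \<Longrightarrow> 0 \<le> q' i \<and> q' i \<le> 1"
  let ?r = "\<lambda>i v. (pmf (bernoulli_pmf (q i)) v / pmf (bernoulli_pmf (p i)) v) *
     (pmf (bernoulli_pmf (q' i)) v / pmf (bernoulli_pmf (p i)) v)"
  have "measure_pmf.expectation (Pi_pmf I d (\<lambda>i. bernoulli_pmf (p i))) (\<lambda>X. w q X * w q' X) =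
     measure_pmf.expectation (Pi_pmf I d (\<lambda>i. bernoulli_pmf (p i))) (\<lambda>X. \<Prod>i\<in>I. ?r i (X i))"
    by (simp only: w_def prod.distrib)
  also have "\<dots> = (\<Prod>i\<in>I. measure_pmf.expectation (bernoulli_pmf (p i)) (?r i))"
    by (rule expectation_prod_Pi_pmf) (auto simp: I integrable_measure_pmf_finite)
  also have "\<dots> = (\<Prod>i\<in>I. 1 + (q i - p i) * (q' i - p i) / (p i * (1 - p i)))"
  proof (rule prod.cong[OF refl])
    fix i assume i: "i \<in> I"
    \<comment> \<open>In these variables the terms linear in \<open>a\<close> and \<open>b\<close>
      cancel between the outcomes \<open>True\<close> and \<open>False\<close>; what remains
      collapses by \<open>p i + r = 1\<close>.\<close>
    define a b r where "a = q i - p i" and "b = q' i - p i" and "r = 1 - p i"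
    have nz: "r \<noteq> 0" "p i \<noteq> 0" using p[OF i] by (auto simp: r_def)
    have "measure_pmf.expectation (bernoulli_pmf (p i)) (?r i) =
        q i / p i * (q' i / p i) * p i + (1 - q i) / (1 - p i) * ((1 - q' i) / (1 - p i)) * (1 - p i)"
      using p[OF i] q[OF i] q'[OF i] by simp
    also have "\<dots> = (p i + a) / p i * ((p i + b) / p i) * p i + (r - a) / r * ((r - b) / r) * r"
      by (simp add: a_def b_def r_def)
    also have "\<dots> = (p i + a + b + a * b / p i) + (r - a - b + a * b / r)"
      using nz by (simp add: field_simps)
    also have "\<dots> = (p i + r) + a * b * (p i + r) / (p i * r)"
      using nz by (simp add: field_simps)
    finally show "measure_pmf.expectation (bernoulli_pmf (p i)) (?r i) =
        1 + (q i - p i) * (q' i - p i) / (p i * (1 - p i))"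
      by (simp add: a_def b_def r_def)
  qed
  finally show "measure_pmf.expectation (Pi_pmf I d (\<lambda>i. bernoulli_pmf (p i))) (\<lambda>X. w q X * w q' X) =
        (\<Prod>i\<in>I. 1 + (q i - p i) * (q' i - p i) / (p i * (1 - p i)))" .
qed

section \<open>Sums over edges and the edge probabilities\<close>

definition edges :: "nat \<Rightarrow> (nat \<times> nat) set" where
  "edges n = {(i, j). 1 \<le> i \<and> i < j \<and> j \<le> n}"

lemma finite_edges: "finite (edges n)"
  by (rule finite_subset[of _ "{1..n} \<times> {1..n}"]) (auto simp: edges_def)

text \<open>The ordered pairs off the diagonal are the edges together with their reversals. This is
  the passage between sums of degrees and sums over edges.\<close>

lemma sum_off_diagonal:
  fixes h :: "nat \<Rightarrow> nat \<Rightarrow> 'a::comm_monoid_add"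
  shows "(\<Sum>i=1..n. \<Sum>j\<in>{1..n} - {i}. h i j) = (\<Sum>(i, j)\<in>edges n. h i j + h j i)"
proof -
  have "(\<Sum>i=1..n. \<Sum>j\<in>{1..n} - {i}. h i j) = (\<Sum>(i, j)\<in>(SIGMA i:{1..n}. {1..n} - {i}). h i j)"
    by (rule sum.Sigma) auto
  also have "(SIGMA i:{1..n}. {1..n} - {i}) = edges n \<union> prod.swap ` edges n"
    by (auto simp: edges_def image_def)
  also have "(\<Sum>(i, j)\<in>edges n \<union> prod.swap ` edges n. h i j) =
      (\<Sum>(i, j)\<in>edges n. h i j) + (\<Sum>(i, j)\<in>prod.swap ` edges n. h i j)"
    using finite_edges by (intro sum.union_disjoint) (auto simp: edges_def)
  also have "(\<Sum>(i, j)\<in>prod.swap ` edges n. h i j) = (\<Sum>(i, j)\<in>edges n. h j i)"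
    by (subst sum.reindex) (auto simp: case_prod_unfold)
  finally show ?thesis
    by (simp add: sum.distrib case_prod_unfold)
qed

text \<open>Each vertex lies on \<open>n - 1\<close> edges.\<close>

lemma sum_edges_add:
  fixes a :: "nat \<Rightarrow> real"
  assumes "n \<ge> 1"
  shows "(\<Sum>(i, j)\<in>edges n. a i + a j) = (real n - 1) * (\<Sum>i=1..n. a i)"
  using assms by (subst sum_off_diagonal[of "\<lambda>i j. a i", symmetric])
    (simp add: sum_distrib_left of_nat_diff)

text \<open>The summand on the left is the symmetrization of \<open>a i * b i + a i * b j\<close>;
  adding the nonnegative diagonal terms completes the double sum. For indicators of two sets the
  bound is \<open>n\<close> times their overlap plus the product of their sizes.\<close>

lemma sum_edges_mult_le:
  fixes a b :: "nat \<Rightarrow> real"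
  assumes "\<And>i. a i \<ge> 0" "\<And>i. b i \<ge> 0"
  shows "(\<Sum>(i, j)\<in>edges n. (a i + a j) * (b i + b j)) \<le>
    real n * (\<Sum>i=1..n. a i * b i) + (\<Sum>i=1..n. a i) * (\<Sum>i=1..n. b i)"
proof -
  have "(\<Sum>(i, j)\<in>edges n. (a i + a j) * (b i + b j)) = (\<Sum>i=1..n. \<Sum>j\<in>{1..n} - {i}. a i * b i + a i * b j)"
    by (subst sum_off_diagonal) (simp add: algebra_simps)
  also have "\<dots> \<le> (\<Sum>i=1..n. \<Sum>j=1..n. a i * b i + a i * b j)"
    using assms by (intro sum_mono sum_mono2) auto
  also have "\<dots> = real n * (\<Sum>i=1..n. a i * b i) + (\<Sum>i=1..n. a i) * (\<Sum>i=1..n. b i)"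
    by (simp add: sum.distrib sum_product) (simp add: sum_distrib_left)
  finally show ?thesis .
qed

text \<open>The independent edge indicators before they are assembled into a matrix; probabilities
  of tests are pulled back to this product law.\<close>

definition edge_law :: "nat \<Rightarrow> real \<Rightarrow> (nat \<Rightarrow> real) \<Rightarrow> (nat \<times> nat \<Rightarrow> bool) pmf" where
  "edge_law n lam \<beta> =
     Pi_pmf (edges n) False (\<lambda>e. bernoulli_pmf (edge_prob n lam \<beta> (fst e) (snd e)))"

lemma prob_graph_law:
  "measure_pmf.prob (graph_law n lam \<beta>) {Y. T Y} =
   measure_pmf.prob (edge_law n lam \<beta>) {X. T (adjacency_matrix X)}"
  by (simp add: graph_law_def edge_law_def edges_def case_prod_unfold vimage_def)

text \<open>The logistic function is an affine image of \<open>tanh\<close> at half the argument.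
  Thus the null edge probability is \<open>lam / (2 * n)\<close>, and the signal enters only as a
  relative excess given by \<open>tanh\<close>.\<close>

lemma edge_prob_tanh:
  "edge_prob n lam \<beta> i j = lam / (2 * real n) * (1 + tanh ((\<beta> i + \<beta> j) / 2))"
proof -
  have logistic: "exp x / (1 + exp x) = (1 + tanh (x / 2)) / 2" for x :: real
  proof -
    have nz: "1 + exp x \<noteq> 0" by (metis add_pos_pos exp_gt_zero less_irrefl zero_less_one)
    have "1 - exp (- x) = (exp x - 1) / exp x" "1 + exp (- x) = (1 + exp x) / exp x"
      by (simp_all add: exp_minus field_simps)
    then have "tanh (x / 2) = (exp x - 1) / (1 + exp x)" by (simp add: tanh_real_altdef)
    then show ?thesis using nz by (simp add: field_simps)
  qed
  show ?thesis unfolding edge_prob_def logistic by simp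
qed

lemma edge_prob_bounds:
  assumes "1 \<le> lam" "lam \<le> real n"
  shows "0 \<le> edge_prob n lam \<beta> i j" "edge_prob n lam \<beta> i j \<le> lam / real n" "edge_prob n lam \<beta> i j \<le> 1"
proof -
  let ?x = "exp (\<beta> i + \<beta> j) / (1 + exp (\<beta> i + \<beta> j))"
  have x: "0 \<le> ?x" "?x \<le> 1" by (auto simp: divide_le_eq add_pos_pos)
  have l: "0 \<le> lam / real n" "lam / real n \<le> 1" using assms by auto
  show "0 \<le> edge_prob n lam \<beta> i j"
    unfolding edge_prob_def using l(1) x(1) by (rule mult_nonneg_nonneg)
  show le: "edge_prob n lam \<beta> i j \<le> lam / real n"
    unfolding edge_prob_def using mult_left_mono[OF x(2) l(1)] by simp
  show "edge_prob n lam \<beta> i j \<le> 1" using le l by simp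
qed

lemma sum_vertex_degree:
  "real (\<Sum>i=1..n. vertex_degree n (adjacency_matrix X) i) = 2 * (\<Sum>e\<in>edges n. of_bool (X e))"
proof -
  have "real (\<Sum>i=1..n. vertex_degree n (adjacency_matrix X) i) =
      (\<Sum>(i, j)\<in>edges n. real (adjacency_matrix X i j) + real (adjacency_matrix X j i))"
    unfolding sum_off_diagonal[of "\<lambda>i j. real (adjacency_matrix X i j)", symmetric]
    by (simp add: vertex_degree_def)
  also have "\<dots> = (\<Sum>e\<in>edges n. 2 * of_bool (X e))"
    by (intro sum.cong) (auto simp: edges_def adjacency_matrix_def)
  finally show ?thesis by (simp add: sum_distrib_left)
qed

section \<open>The total degree test\<close>

text \<open>The total degree is twice the edge count, so a deviation \<open>K\<close> is one of
  \<open>K / 2\<close> for the count; this produces the factor 4. The variance of the count is at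
  most its mean \<open>\<mu>\<close>, for which the generous bound \<open>n * lam\<close> is
  enough.\<close>

lemma total_degree_deviation:
  fixes \<beta> :: "nat \<Rightarrow> real"
  assumes "1 \<le> lam" "lam \<le> real n" "K > 0"
  defines "\<mu> \<equiv> \<Sum>(i, j)\<in>edges n. edge_prob n lam \<beta> i j"
  assumes E: "\<And>X. X \<in> E \<Longrightarrow> \<bar>real (\<Sum>i=1..n. vertex_degree n (adjacency_matrix X) i) - 2 * \<mu>\<bar> \<ge> K"
  shows "measure_pmf.prob (edge_law n lam \<beta>) E \<le> 4 * real n * lam / K\<^sup>2"
proof -
  let ?q = "\<lambda>e. edge_prob n lam \<beta> (fst e) (snd e)"
  have n: "real n > 0" using assms by linarith
  have mu: "sum ?q (edges n) = \<mu>" by (simp add: \<mu>_def case_prod_unfold)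
  have "measure_pmf.prob (edge_law n lam \<beta>) E \<le> sum ?q (edges n) / (K / 2)\<^sup>2"
    unfolding edge_law_def
  proof (rule bernoulli_Pi_pmf_deviation)
    show "E \<subseteq> {X. K / 2 \<le> \<bar>(\<Sum>e\<in>edges n. of_bool (X e)) - sum ?q (edges n)\<bar>}"
    proof
      fix X assume "X \<in> E"
      from E[OF this] show "X \<in> {X. K / 2 \<le> \<bar>(\<Sum>e\<in>edges n. of_bool (X e)) - sum ?q (edges n)\<bar>}"
        unfolding mu sum_vertex_degree by (auto simp: abs_if split: if_splits)
    qed
  qed (use assms edge_prob_bounds finite_edges in auto)
  also have "\<dots> = 4 * \<mu> / K\<^sup>2" by (simp add: mu power_divide)
  \<comment> \<open>The bound \<open>lam / n\<close> on an edge probability is split evenly between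
    the two orientations to fit \<open>sum_off_diagonal\<close>.\<close>
  also have "\<mu> \<le> (\<Sum>(i, j)\<in>edges n. lam / (2 * real n) + lam / (2 * real n))"
    unfolding \<mu>_def using edge_prob_bounds[OF assms(1,2), of \<beta>] by (intro sum_mono) auto
  also have "\<dots> = (\<Sum>i=1..n. \<Sum>j\<in>{1..n} - {i}. lam / (2 * real n))"
    by (rule sum_off_diagonal[symmetric])
  also have "\<dots> \<le> (\<Sum>i=1..n. \<Sum>j=1..n. lam / (2 * real n))"
    using assms by (intro sum_mono sum_mono2) auto
  also have "\<dots> = real n * lam / 2" using n by simp
  also have "\<dots> \<le> real n * lam" using assms n by simp
  finally show ?thesis by (simp add: divide_right_mono mult_ac)
qed

text \<open>An edge with only one endpoint in the support may have just \<open>A / 2\<close> as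
  argument of \<open>tanh\<close>; the doubling formula recovers \<open>tanh A\<close> at the cost
  of a factor 2.\<close>

lemma tanh_half_ge:
  fixes x :: real
  assumes "x \<ge> 0"
  shows "tanh x / 2 \<le> tanh (x / 2)"
proof -
  let ?t = "tanh (x / 2)"
  have t: "?t \<ge> 0" using assms by simp
  have "tanh (x / 2 + x / 2) = (?t + ?t) / (1 + ?t * ?t)"
    by (rule tanh_add) auto
  then have "tanh x = 2 * ?t / (1 + ?t\<^sup>2)" by (simp add: power2_eq_square)
  also have "\<dots> \<le> 2 * ?t"
    using t by (simp add: divide_le_eq add_pos_nonneg mult_le_cancel_left1)
  finally show ?thesis by simp
qed

text \<open>Each edge gains at least \<open>c * tanh A / 4\<close> per endpoint in the support, and
  each support vertex lies on \<open>n - 1\<close> edges. With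
  \<open>(n - 1) * c \<ge> lam / 4\<close> the edge count gains
  \<open>lam * tanh A * s / 16\<close>, and the total degree twice that.\<close>

lemma expected_edges_alternative:
  assumes n: "n \<ge> 2" and lam: "1 \<le> lam" "lam \<le> real n" and A: "A > 0" and \<beta>: "\<beta> \<in> Xi n s A"
  shows "2 * (\<Sum>(i, j)\<in>edges n. edge_prob n lam \<beta> i j) \<ge> lam * (real n - 1) / 2 + lam * tanh A * real s / 8"
proof -
  define a :: "nat \<Rightarrow> real" where "a i = of_bool (i \<in> beta_support n \<beta>)" for i
  define c where "c = lam / (2 * real n)"
  have c: "c \<ge> 0" using lam by (simp add: c_def)
  have T: "tanh A > 0" using A by simp
  have "(\<Sum>i=1..n. a i) = real s"
  proof -
    have "{1..n} \<inter> {i. i \<in> beta_support n \<beta>} = beta_support n \<beta>" by (auto simp: beta_support_def)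
    then have "(\<Sum>i=1..n. a i) = real (card (beta_support n \<beta>))" by (simp add: a_def)
    then show ?thesis using \<beta> by (simp add: Xi_def)
  qed
  note sum_a = this
  \<comment> \<open>Both the baseline \<open>c\<close> and the gain are divided between the
    endpoints, as \<open>sum_edges_add\<close> requires.\<close>
  have one: "edge_prob n lam \<beta> i j \<ge> (c / 2 + c * tanh A / 4 * a i) + (c / 2 + c * tanh A / 4 * a j)"
    if "(i, j) \<in> edges n" for i j
  proof -
    have ij: "i \<in> {1..n}" "j \<in> {1..n}" using that by (auto simp: edges_def)
    have nonneg: "\<beta> i \<ge> 0" "\<beta> j \<ge> 0" using \<beta> ij by (auto simp: Xi_def PiE_def Pi_def)
    have large: "\<beta> k \<ge> A" if "k \<in> beta_support n \<beta>" for k using \<beta> that by (auto simp: Xi_def)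
    have "tanh A / 4 * (a i + a j) \<le> tanh ((\<beta> i + \<beta> j) / 2)"
    proof (cases "i \<in> beta_support n \<beta> \<or> j \<in> beta_support n \<beta>")
      case True
      then have "A \<le> \<beta> i + \<beta> j" using large nonneg by force
      then have "tanh (A / 2) \<le> tanh ((\<beta> i + \<beta> j) / 2)" by simp
      \<comment> \<open>Even with both endpoints in the support the claim asks only for
        \<open>tanh A / 2\<close>, which \<open>tanh_half_ge\<close> supplies.\<close>
      moreover have "tanh A / 4 * (a i + a j) \<le> tanh A / 4 * 2"
        using T by (intro mult_left_mono) (auto simp: a_def)
      ultimately show ?thesis using tanh_half_ge[of A] A by linarith
    next
      case False
      then show ?thesis using nonneg by (simp add: a_def)
    qed
    from mult_left_mono[OF this c] have "c * (tanh A / 4 * (a i + a j)) \<le> c * tanh ((\<beta> i + \<beta> j) / 2)" .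
    moreover have "edge_prob n lam \<beta> i j = c + c * tanh ((\<beta> i + \<beta> j) / 2)"
      by (simp add: edge_prob_tanh c_def algebra_simps)
    ultimately show ?thesis by (simp add: algebra_simps)
  qed
  have "(real n - 1) * (real n * c / 2 + c * tanh A / 4 * real s) =
      (real n - 1) * (\<Sum>i=1..n. c / 2 + c * tanh A / 4 * a i)"
    unfolding sum_a[symmetric] sum.distrib sum_distrib_left by simp
  also have "\<dots> = (\<Sum>(i, j)\<in>edges n. (c / 2 + c * tanh A / 4 * a i) + (c / 2 + c * tanh A / 4 * a j))"
    using n by (intro sum_edges_add[symmetric]) auto
  also have "\<dots> \<le> (\<Sum>(i, j)\<in>edges n. edge_prob n lam \<beta> i j)"
    using one by (intro sum_mono) auto
  finally have "(real n - 1) * (real n * c / 2 + c * tanh A / 4 * real s) \<le> (\<Sum>(i, j)\<in>edges n. edge_prob n lam \<beta> i j)" .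
  moreover have "(real n - 1) * (real n * c / 2 + c * tanh A / 4 * real s) =
      lam * (real n - 1) / 4 + (real n - 1) * (c * tanh A / 4 * real s)"
    using n by (simp add: c_def distrib_left mult.commute)
  moreover have "(real n - 1) * (c * tanh A / 4 * real s) \<ge> lam * tanh A * real s / 16"
  proof -
    have "(real n - 1) * c \<ge> lam / 4" using n lam by (simp add: c_def field_simps)
    then have "(real n - 1) * c * (tanh A / 4 * real s) \<ge> lam / 4 * (tanh A / 4 * real s)"
      using T by (intro mult_right_mono) auto
    then show ?thesis by (simp add: algebra_simps)
  qed
  ultimately show ?thesis by linarith
qed

lemma expected_edges_null:
  assumes "n \<ge> 1"
  shows "2 * (\<Sum>(i, j)\<in>edges n. edge_prob n lam (\<lambda>_. 0) i j) = lam * (real n - 1) / 2"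
  using sum_edges_add[of n "\<lambda>_. lam / (4 * real n)"] assms
  by (simp add: edge_prob_tanh algebra_simps)

text \<open>The threshold is at most half the shift of the mean, so an error of either kind is a
  deviation of at least \<open>K\<close> from the true mean.\<close>

lemma risk_total_degree_test_le:
  assumes n: "n \<ge> 2" and lam: "1 \<le> lam" "lam \<le> real n" and A: "A > 0"
    and K: "K > 0" "2 * K \<le> lam * tanh A * real s / 8" and ne: "Xi n s A \<noteq> {}"
  shows "risk n lam (Xi n s A) (total_degree_test n lam K) \<le> 8 * real n * lam / K\<^sup>2"
proof -
  have "measure_pmf.prob (graph_law n lam (\<lambda>_. 0)) {Y. total_degree_test n lam K Y} \<le> 4 * real n * lam / K\<^sup>2"
    unfolding prob_graph_law
  proof (rule total_degree_deviation[OF lam K(1)])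
    show "K \<le> \<bar>real (\<Sum>i=1..n. vertex_degree n (adjacency_matrix X) i) -
        2 * (\<Sum>(i, j)\<in>edges n. edge_prob n lam (\<lambda>_. 0) i j)\<bar>"
      if "X \<in> {X. total_degree_test n lam K (adjacency_matrix X)}" for X
      using that n K by (subst expected_edges_null) (auto simp: total_degree_test_def)
  qed
  moreover have "(SUP \<beta>\<in>Xi n s A. measure_pmf.prob (graph_law n lam \<beta>) {Y. \<not> total_degree_test n lam K Y})
      \<le> 4 * real n * lam / K\<^sup>2"
  proof (rule cSUP_least[OF ne])
    fix \<beta> assume \<beta>: "\<beta> \<in> Xi n s A"
    show "measure_pmf.prob (graph_law n lam \<beta>) {Y. \<not> total_degree_test n lam K Y} \<le> 4 * real n * lam / K\<^sup>2"
      unfolding prob_graph_law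
    proof (rule total_degree_deviation[OF lam K(1)])
      show "K \<le> \<bar>real (\<Sum>i=1..n. vertex_degree n (adjacency_matrix X) i) -
          2 * (\<Sum>(i, j)\<in>edges n. edge_prob n lam \<beta> i j)\<bar>"
        if "X \<in> {X. \<not> total_degree_test n lam K (adjacency_matrix X)}" for X
        using that expected_edges_alternative[OF n lam A \<beta>] K
        by (auto simp: total_degree_test_def)
    qed
  qed
  ultimately have "risk n lam (Xi n s A) (total_degree_test n lam K) \<le>
      4 * real n * lam / K\<^sup>2 + 4 * real n * lam / K\<^sup>2"
    unfolding risk_def by (rule add_mono)
  then show ?thesis by (simp add: mult_ac flip: add_divide_distrib)
qed

section \<open>The block prior and its overlaps\<close>

text \<open>Block \<open>k\<close> is \<open>{k * m + 1..k * m + m}\<close>, and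
  \<open>f k < m\<close> is the position chosen in it; the offset 1 is there because vertices are
  numbered from 1.\<close>

definition block_selection :: "nat \<Rightarrow> nat \<Rightarrow> (nat \<Rightarrow> nat) \<Rightarrow> nat set" where
  "block_selection s m f = (\<lambda>k. k * m + f k + 1) ` {..<s}"

definition block_choices :: "nat \<Rightarrow> nat \<Rightarrow> (nat \<Rightarrow> nat) set" where
  "block_choices s m = {..<s} \<rightarrow>\<^sub>E {..<m}"

lemma block_vertex_eq_iff:
  fixes k l m v w :: nat
  assumes "v < m" "w < m"
  shows "k * m + v = l * m + w \<longleftrightarrow> k = l \<and> v = w"
proof
  assume eq: "k * m + v = l * m + w"
  have "(k * m + v) div m = k" "(l * m + w) div m = l" using assms by auto
  with eq have "k = l" by simp
  with eq show "k = l \<and> v = w" by simp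
qed simp

text \<open>By division with remainder a vertex determines its block and its position, so common
  vertices correspond to the blocks where \<open>f\<close> and \<open>g\<close> agree.\<close>

lemma card_block_selection_Int:
  assumes "f \<in> block_choices s m" "g \<in> block_choices s m"
  shows "card (block_selection s m f \<inter> block_selection s m g) = card {k \<in> {..<s}. f k = g k}"
proof -
  have less: "f k < m" "g k < m" if "k < s" for k
    using assms that by (auto simp: block_choices_def PiE_def Pi_def)
  have "k = l \<and> f k = g l" if "k < s" "l < s" "k * m + f k + 1 = l * m + g l + 1" for k l
    using block_vertex_eq_iff[OF less(1)[OF that(1)] less(2)[OF that(2)], of k l] that(3) by simp
  then have "block_selection s m f \<inter> block_selection s m g = (\<lambda>k. k * m + f k + 1) ` {k \<in> {..<s}. f k = g k}"
    unfolding block_selection_def by (intro set_eqI iffI) (blast, fastforce)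
  moreover have "inj_on (\<lambda>k. k * m + f k + 1) {k \<in> {..<s}. f k = g k}"
  proof (rule inj_onI)
    fix k l assume "k \<in> {k \<in> {..<s}. f k = g k}" "l \<in> {k \<in> {..<s}. f k = g k}"
      and eq: "k * m + f k + 1 = l * m + f l + 1"
    then have "f k < m" "f l < m" using less by auto
    from block_vertex_eq_iff[OF this, of k l] eq show "k = l" by simp
  qed
  ultimately show ?thesis by (simp only: card_image)
qed

lemma card_block_selection:
  assumes "f \<in> block_choices s m"
  shows "card (block_selection s m f) = s"
  using card_block_selection_Int[OF assms assms] by simp

lemma block_selection_subset:
  assumes "f \<in> block_choices s m" "s * m \<le> n"
  shows "block_selection s m f \<subseteq> {1..n}"
proof -
  have "k * m + f k + 1 \<le> n" if "k < s" for k
  proof -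
    have "f k < m" using assms(1) that by (auto simp: block_choices_def PiE_def Pi_def)
    moreover have "Suc k * m \<le> s * m" using that by (intro mult_right_mono) auto
    ultimately show ?thesis using assms(2) by simp
  qed
  then show ?thesis by (auto simp: block_selection_def)
qed

lemma exp_sub_one_le:
  fixes x :: real
  assumes "0 \<le> x" "x \<le> 1"
  shows "exp x - 1 \<le> 2 * x"
proof -
  have "exp x \<le> 1 + x + x\<^sup>2" using assms by (rule exp_bound)
  moreover have "x\<^sup>2 \<le> x" using assms by (simp add: power2_eq_square mult_left_le)
  ultimately show ?thesis by simp
qed

text \<open>Up to normalization this is the moment generating function of the overlap of a fixed
  \<open>f\<close> with a uniform \<open>g\<close>. It factorizes over blocks, and each block
  contributes \<open>m - 1 + exp \<theta>\<close>.\<close>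

lemma sum_exp_block_agreements_le:
  fixes \<theta> :: real
  assumes f: "f \<in> block_choices s m" and m: "m \<ge> 1" and \<theta>: "0 \<le> \<theta>" "\<theta> \<le> 1"
  shows "(\<Sum>g\<in>block_choices s m. exp (\<theta> * card {k \<in> {..<s}. f k = g k})) \<le>
    real (card (block_choices s m)) * exp (2 * \<theta> * s / m)"
proof -
  have "(\<Sum>g\<in>block_choices s m. exp (\<theta> * card {k \<in> {..<s}. f k = g k})) =
      (\<Sum>g\<in>block_choices s m. \<Prod>k<s. exp (\<theta> * of_bool (f k = g k)))"
  proof (rule sum.cong[OF refl])
    fix g
    have "{..<s} \<inter> {k. f k = g k} = {k \<in> {..<s}. f k = g k}" by auto
    then show "exp (\<theta> * card {k \<in> {..<s}. f k = g k}) = (\<Prod>k<s. exp (\<theta> * of_bool (f k = g k)))"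
      by (simp add: exp_sum[symmetric] flip: sum_distrib_left)
  qed
  \<comment> \<open>Exchanging product and sum over \<open>PiE\<close> expresses the independence of
    the blocks.\<close>
  also have "\<dots> = (\<Prod>k<s. \<Sum>v<m. exp (\<theta> * of_bool (f k = v)))"
    unfolding block_choices_def by (rule prod_sum_PiE[symmetric]) auto
  also have "\<dots> \<le> (\<Prod>k<s. real m * exp (2 * \<theta> / m))"
  proof (rule prod_mono, safe)
    fix k assume "k < s"
    then have fk: "f k < m" using f by (auto simp: block_choices_def PiE_def Pi_def)
    have "(\<Sum>v<m. exp (\<theta> * of_bool (f k = v))) = (\<Sum>v<m. 1 + (if v = f k then exp \<theta> - 1 else 0))"
      by (intro sum.cong) auto
    also have "\<dots> = real m + (exp \<theta> - 1)"
      using fk by (simp add: sum.distrib)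
    also have "\<dots> \<le> real m + 2 * \<theta>"
      using exp_sub_one_le[OF \<theta>] by simp
    also have "\<dots> = real m * (1 + 2 * \<theta> / m)"
      using m by (simp add: field_simps)
    also have "\<dots> \<le> real m * exp (2 * \<theta> / m)"
      by (intro mult_left_mono exp_ge_add_one_self) auto
    finally show "(\<Sum>v<m. exp (\<theta> * of_bool (f k = v))) \<le> real m * exp (2 * \<theta> / m)" .
  qed (auto intro: sum_nonneg)
  also have "\<dots> = real (card (block_choices s m)) * exp (2 * \<theta> * s / m)"
    by (simp add: block_choices_def card_PiE power_mult_distrib exp_of_nat_mult[symmetric] mult_ac)
  finally show ?thesis .
qed

section \<open>Planted alternatives and the lower bound on the risk\<close>

text \<open>The \<open>restrict\<close> is needed because the members of \<open>Xi\<close> are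
  extensional functions.\<close>

definition planted :: "nat \<Rightarrow> real \<Rightarrow> nat set \<Rightarrow> nat \<Rightarrow> real" where
  "planted n A S = restrict (\<lambda>i. A * of_bool (i \<in> S)) {1..n}"

lemma planted_in_Xi:
  assumes "S \<subseteq> {1..n}" "A > 0"
  shows "planted n A S \<in> Xi n (card S) A"
proof -
  have "beta_support n (planted n A S) = S"
    using assms by (auto simp: beta_support_def planted_def)
  then show ?thesis using assms by (auto simp: Xi_def planted_def)
qed

text \<open>The relative excess is \<open>tanh\<close> at \<open>0\<close>, \<open>A / 2\<close> or
  \<open>A\<close>, according to the number of endpoints in \<open>S\<close>.\<close>

lemma edge_prob_planted:
  assumes "(i, j) \<in> edges n" "0 \<le> lam" "A > 0"
  defines "p \<equiv> edge_prob n lam (\<lambda>_. 0) i j"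
  shows "0 \<le> edge_prob n lam (planted n A S) i j - p"
    and "edge_prob n lam (planted n A S) i j - p \<le> p * (tanh A * (of_bool (i \<in> S) + of_bool (j \<in> S)))"
proof -
  let ?t = "tanh ((A * of_bool (i \<in> S) + A * of_bool (j \<in> S)) / 2)"
  have p: "p = lam / (2 * real n)" "p \<ge> 0" using assms by (auto simp: p_def edge_prob_tanh)
  have diff: "edge_prob n lam (planted n A S) i j - p = p * ?t"
    using assms(1) by (auto simp: edge_prob_tanh p(1) planted_def edges_def algebra_simps)
  have T: "tanh A > 0" "tanh (A / 2) \<le> tanh A" using assms(3) by auto
  have t: "0 \<le> ?t" "?t \<le> tanh A * (of_bool (i \<in> S) + of_bool (j \<in> S))"
    using T assms(3) by auto
  show "0 \<le> edge_prob n lam (planted n A S) i j - p"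
    unfolding diff using p(2) t(1) by (rule mult_nonneg_nonneg)
  show "edge_prob n lam (planted n A S) i j - p \<le> p * (tanh A * (of_bool (i \<in> S) + of_bool (j \<in> S)))"
    unfolding diff using t p by (intro mult_left_mono)
qed

text \<open>Each factor is at most the exponential of \<open>\<theta> / n\<close> times a product of
  endpoint counts in \<open>S\<close> and \<open>S'\<close>, and \<open>sum_edges_mult_le\<close>
  sums the exponents. The term in \<open>card (S \<inter> S')\<close> comes from the overlap; the
  term in \<open>s\<close> squared is the global effect of the increased total degree.\<close>

lemma planted_correlation_le:
  assumes lam: "1 \<le> lam" "lam \<le> real n" and A: "A > 0" and \<theta>: "lam * (tanh A)\<^sup>2 \<le> \<theta>"
    and S: "S \<subseteq> {1..n}" "card S = s" and S': "S' \<subseteq> {1..n}" "card S' = s"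
  defines "p \<equiv> \<lambda>e. edge_prob n lam (\<lambda>_. 0) (fst e) (snd e)"
    and "q \<equiv> \<lambda>S e. edge_prob n lam (planted n A S) (fst e) (snd e)"
  shows "(\<Prod>e\<in>edges n. 1 + (q S e - p e) * (q S' e - p e) / (p e * (1 - p e))) \<le>
    exp (\<theta> * card (S \<inter> S') + \<theta> * (real s)\<^sup>2 / n)"
proof -
  define a :: "nat \<Rightarrow> real" where "a i = of_bool (i \<in> S)" for i
  define b :: "nat \<Rightarrow> real" where "b i = of_bool (i \<in> S')" for i
  have n: "real n > 0" using lam by linarith
  have p: "p e = lam / (2 * real n)" for e by (simp add: p_def edge_prob_tanh)
  have p_bounds: "0 < lam / (2 * real n)" "lam / (2 * real n) \<le> 1 / 2" using lam n by (auto simp: field_simps)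
  have T: "tanh A > 0" using A by simp
  let ?x = "\<lambda>e. (a (fst e) + a (snd e)) * (b (fst e) + b (snd e))"
  have factor: "0 \<le> (q S e - p e) * (q S' e - p e) / (p e * (1 - p e))"
      "(q S e - p e) * (q S' e - p e) / (p e * (1 - p e)) \<le> \<theta> / n * ?x e" if e: "e \<in> edges n" for e
  proof -
    have ij: "(fst e, snd e) \<in> edges n" using e by simp
    have lam0: "0 \<le> lam" using lam by simp
    have qS: "0 \<le> q S e - p e" "q S e - p e \<le> p e * (tanh A * (a (fst e) + a (snd e)))"
      unfolding p_def q_def a_def by (rule edge_prob_planted[OF ij lam0 A])+
    have qS': "0 \<le> q S' e - p e" "q S' e - p e \<le> p e * (tanh A * (b (fst e) + b (snd e)))"
      unfolding p_def q_def b_def by (rule edge_prob_planted[OF ij lam0 A])+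
    have pe: "0 < p e" "p e \<le> 1 / 2" using p_bounds by (auto simp: p)
    have x: "?x e \<ge> 0" by (auto simp: a_def b_def)
    show "0 \<le> (q S e - p e) * (q S' e - p e) / (p e * (1 - p e))"
      by (intro divide_nonneg_nonneg mult_nonneg_nonneg qS qS') (use pe in auto)
    have "(q S e - p e) * (q S' e - p e) \<le>
        (p e * (tanh A * (a (fst e) + a (snd e)))) * (p e * (tanh A * (b (fst e) + b (snd e))))"
      by (intro mult_mono qS qS' mult_nonneg_nonneg) (use pe T in \<open>auto simp: a_def\<close>)
    \<comment> \<open>The factor \<open>1 / 2\<close> is isolated to be replaced by
      \<open>1 - p e\<close>, which is at least as large since \<open>lam \<le> n\<close>. After
      division there remains \<open>2 * p e = lam / n\<close>.\<close>
    also have "\<dots> = (p e * 2) * (p e * (1 / 2)) * ((tanh A)\<^sup>2 * ?x e)"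
      by (simp add: power2_eq_square algebra_simps)
    also have "\<dots> \<le> (p e * 2) * (p e * (1 - p e)) * ((tanh A)\<^sup>2 * ?x e)"
      using pe x by (intro mult_right_mono mult_left_mono) auto
    finally have "(q S e - p e) * (q S' e - p e) / (p e * (1 - p e)) \<le> (p e * 2) * ((tanh A)\<^sup>2 * ?x e)"
      using pe by (subst pos_divide_le_eq) (simp_all only: mult_ac, simp)
    also have "\<dots> = lam * (tanh A)\<^sup>2 / n * ?x e"
      using n by (simp add: p)
    also have "\<dots> \<le> \<theta> / n * ?x e"
      using \<theta> n x by (intro mult_right_mono divide_right_mono) auto
    finally show "(q S e - p e) * (q S' e - p e) / (p e * (1 - p e)) \<le> \<theta> / n * ?x e" .
  qed
  have "(\<Prod>e\<in>edges n. 1 + (q S e - p e) * (q S' e - p e) / (p e * (1 - p e))) \<le>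
      (\<Prod>e\<in>edges n. exp (\<theta> / n * ?x e))"
  proof (rule prod_mono, safe)
    fix i j assume e: "(i, j) \<in> edges n"
    show "0 \<le> 1 + (q S (i, j) - p (i, j)) * (q S' (i, j) - p (i, j)) / (p (i, j) * (1 - p (i, j)))"
      using factor(1)[OF e] by linarith
    show "1 + (q S (i, j) - p (i, j)) * (q S' (i, j) - p (i, j)) / (p (i, j) * (1 - p (i, j))) \<le>
        exp (\<theta> / n * ?x (i, j))"
      using factor(2)[OF e] exp_ge_add_one_self[of "\<theta> / n * ?x (i, j)"] by linarith
  qed
  also have "\<dots> = exp (\<theta> / n * (\<Sum>(i, j)\<in>edges n. (a i + a j) * (b i + b j)))"
    by (simp add: exp_sum[OF finite_edges] sum_distrib_left case_prod_unfold)
  also have "\<dots> \<le> exp (\<theta> / n * (real n * (\<Sum>i=1..n. a i * b i) + (\<Sum>i=1..n. a i) * (\<Sum>i=1..n. b i)))"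
  proof -
    have "0 \<le> \<theta>" using \<theta> lam by (smt (verit) zero_le_mult_iff zero_le_power2)
    then show ?thesis
      unfolding exp_le_cancel_iff
      by (intro mult_left_mono sum_edges_mult_le) (auto simp: a_def b_def)
  qed
  also have "(\<Sum>i=1..n. a i) = real s"
    using S by (simp add: a_def Int_absorb1)
  also have "(\<Sum>i=1..n. b i) = real s"
    using S' by (simp add: b_def Int_absorb1)
  also have "(\<Sum>i=1..n. a i * b i) = real (card (S \<inter> S'))"
  proof -
    have "{1..n} \<inter> {i. i \<in> S \<and> i \<in> S'} = S \<inter> S'" using S by auto
    moreover have "a i * b i = of_bool (i \<in> S \<and> i \<in> S')" for i by (simp add: a_def b_def)
    ultimately show ?thesis by simp
  qed
  finally show ?thesis
    using n by (simp add: field_simps power2_eq_square)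
qed

text \<open>The block prior is inserted into \<open>mixture_risk_bound\<close>. The constant 5 is 4
  from the overlaps, through \<open>1 / m \<le> 2 * s / n\<close>, plus 1 from the global term of
  \<open>planted_correlation_le\<close>.\<close>

lemma risk_ge:
  assumes s: "1 \<le> s" "s \<le> n" and lam: "1 \<le> lam" "lam \<le> real n" and A: "A > 0"
    and \<theta>: "lam * (tanh A)\<^sup>2 \<le> \<theta>" "\<theta> \<le> 1"
  shows "1 - sqrt (exp (5 * \<theta> * (real s)\<^sup>2 / n) - 1) \<le> risk n lam (Xi n s A) T"
proof -
  define m where "m = n div s"
  have m: "m \<ge> 1" "s * m \<le> n" using s by (auto simp: m_def div_greater_zero_iff Suc_le_eq)
  \<comment> \<open>Rounding \<open>n / s\<close> down to \<open>m\<close> loses at most a factor 2,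
    because \<open>m \<ge> 1\<close>.\<close>
  have "n < s * (m + 1)"
    using s dividend_less_div_times[of s n] by (simp add: m_def algebra_simps)
  also have "\<dots> \<le> s * (2 * m)" using m by (intro mult_left_mono) auto
  finally have "real n \<le> 2 * real s * real m"
    by (metis less_imp_le mult.assoc mult.left_commute of_nat_le_iff of_nat_mult of_nat_numeral)
  then have inv_m: "1 / real m \<le> 2 * real s / n" using m s by (simp add: field_simps)
  have n: "real n > 0" using s by simp
  have \<theta>0: "0 \<le> \<theta>" using \<theta> lam by (smt (verit) zero_le_mult_iff zero_le_power2)
  define F where "F = block_choices s m"
  have F: "finite F" "F \<noteq> {}"
    using m by (auto simp: F_def block_choices_def PiE_eq_empty_iff lessThan_empty_iff intro!: finite_PiE)
  define S where "S = block_selection s m"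
  have S: "S f \<subseteq> {1..n}" "card (S f) = s" if "f \<in> F" for f
    using that block_selection_subset m card_block_selection by (auto simp: S_def F_def)
  define p where "p = (\<lambda>e. edge_prob n lam (\<lambda>_. 0) (fst e) (snd e))"
  define q where "q = (\<lambda>f e. edge_prob n lam (planted n A (S f)) (fst e) (snd e))"
  define w where "w = (\<lambda>f X. \<Prod>e\<in>edges n. pmf (bernoulli_pmf (q f e)) (X e) / pmf (bernoulli_pmf (p e)) (X e))"
  have p: "0 < p e \<and> p e < 1" for e
    using lam n by (auto simp: p_def edge_prob_tanh field_simps)
  have q: "0 \<le> q f e \<and> q f e \<le> 1" for f e
    using edge_prob_bounds[OF lam] by (simp add: q_def)
  let ?P = "edge_law n lam (\<lambda>_. 0)" and ?Q = "\<lambda>f. edge_law n lam (planted n A (S f))"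
  have pair: "measure_pmf.expectation ?P (\<lambda>X. w f X * w g X) \<le>
      exp (\<theta> * card {k \<in> {..<s}. f k = g k}) * exp (\<theta> * (real s)\<^sup>2 / n)" if "f \<in> F" "g \<in> F" for f g
  proof -
    have "measure_pmf.expectation ?P (\<lambda>X. w f X * w g X) =
        (\<Prod>e\<in>edges n. 1 + (q f e - p e) * (q g e - p e) / (p e * (1 - p e)))"
      unfolding edge_law_def w_def p_def[symmetric]
      using bernoulli_Pi_pmf_likelihood_ratio(2)[OF finite_edges p] q by (simp add: p_def)
    also have "\<dots> \<le> exp (\<theta> * card (S f \<inter> S g) + \<theta> * (real s)\<^sup>2 / n)"
      unfolding p_def q_def using that S by (intro planted_correlation_le lam A \<theta>)
    also have "card (S f \<inter> S g) = card {k \<in> {..<s}. f k = g k}"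
      unfolding S_def using that by (intro card_block_selection_Int) (auto simp: F_def)
    finally show ?thesis by (simp add: exp_add)
  qed
  have "(\<Sum>f\<in>F. \<Sum>g\<in>F. measure_pmf.expectation ?P (\<lambda>X. w f X * w g X)) \<le>
      (\<Sum>f\<in>F. (\<Sum>g\<in>F. exp (\<theta> * card {k \<in> {..<s}. f k = g k})) * exp (\<theta> * (real s)\<^sup>2 / n))"
    unfolding sum_distrib_right using pair by (intro sum_mono)
  also have "\<dots> \<le> (\<Sum>f\<in>F. real (card F) * exp (2 * \<theta> * s / m) * exp (\<theta> * (real s)\<^sup>2 / n))"
    unfolding F_def using sum_exp_block_agreements_le m \<theta>0 \<theta>
    by (intro sum_mono mult_right_mono) auto
  also have "\<dots> = exp (2 * \<theta> * s / m + \<theta> * (real s)\<^sup>2 / n) * (real (card F))\<^sup>2"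
    by (simp add: exp_add power2_eq_square)
  also have "\<dots> \<le> exp (5 * \<theta> * (real s)\<^sup>2 / n) * (real (card F))\<^sup>2"
  proof -
    have "2 * \<theta> * s / m \<le> 2 * \<theta> * s * (2 * real s / n)"
      using mult_left_mono[OF inv_m, of "2 * \<theta> * s"] \<theta>0 by simp
    moreover have "5 * \<theta> * (real s)\<^sup>2 / n = 2 * \<theta> * s * (2 * real s / n) + \<theta> * (real s)\<^sup>2 / n"
      using n by (simp add: power2_eq_square field_simps)
    ultimately have "2 * \<theta> * s / m + \<theta> * (real s)\<^sup>2 / n \<le> 5 * \<theta> * (real s)\<^sup>2 / n"
      by linarith
    then show ?thesis by (intro mult_right_mono) auto
  qed
  finally have second: "(\<Sum>f\<in>F. \<Sum>g\<in>F. measure_pmf.expectation ?P (\<lambda>X. w f X * w g X)) \<le>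
      (1 + (exp (5 * \<theta> * (real s)\<^sup>2 / n) - 1)) * (real (card F))\<^sup>2" by simp
  let ?R = "{X. T (adjacency_matrix X)}"
  \<comment> \<open>The supremum in the risk is the \<open>b\<close> of
    \<open>mixture_risk_bound\<close>, since every planted vector of the prior lies in
    \<open>Xi n s A\<close>.\<close>
  have "1 - sqrt (exp (5 * \<theta> * (real s)\<^sup>2 / n) - 1) \<le> measure_pmf.prob ?P ?R +
      (SUP \<beta>\<in>Xi n s A. measure_pmf.prob (graph_law n lam \<beta>) {Y. \<not> T Y})"
  proof (rule mixture_risk_bound[OF F _ _ second])
    show "finite (set_pmf ?P)"
      by (simp add: edge_law_def set_Pi_pmf finite_edges finite_PiE_dflt)
    show "pmf (?Q f) X = pmf ?P X * w f X" for f X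
      unfolding edge_law_def w_def
      using bernoulli_Pi_pmf_likelihood_ratio(1)[OF finite_edges p] by (simp add: p_def q_def)
    fix f assume f: "f \<in> F"
    have "measure_pmf.prob (?Q f) (- ?R) = measure_pmf.prob (graph_law n lam (planted n A (S f))) {Y. \<not> T Y}"
      unfolding prob_graph_law by (simp add: Collect_neg_eq)
    also have "\<dots> \<le> (SUP \<beta>\<in>Xi n s A. measure_pmf.prob (graph_law n lam \<beta>) {Y. \<not> T Y})"
    proof (rule cSUP_upper)
      show "planted n A (S f) \<in> Xi n s A"
        using planted_in_Xi[OF S(1)[OF f] A] S(2)[OF f] by simp
      show "bdd_above ((\<lambda>\<beta>. measure_pmf.prob (graph_law n lam \<beta>) {Y. \<not> T Y}) ` Xi n s A)"
        by (rule bdd_aboveI[of _ 1]) auto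
    qed
    finally show "measure_pmf.prob (?Q f) (- ?R) \<le>
        (SUP \<beta>\<in>Xi n s A. measure_pmf.prob (graph_law n lam \<beta>) {Y. \<not> T Y})" .
  qed
  then show ?thesis by (simp add: risk_def prob_graph_law)
qed

section \<open>Asymptotics in \<open>n\<close>\<close>

lemma powr_limit_0:
  fixes c d :: real
  assumes "d > 0"
  shows "(\<lambda>n. c * real n powr (- d)) \<longlonglongrightarrow> 0"
  using assms by (intro tendsto_mult_right_zero tendsto_neg_powr filterlim_real_sequentially) simp

text \<open>As \<open>n powr (1 - \<alpha>)\<close> is at least 1, an integer at distance less than
  1 from it is positive and agrees with it up to a factor 2.\<close>

lemma sparsity_bounds:
  fixes s n :: nat and \<alpha> :: real
  assumes "n \<ge> 1" "0 < \<alpha>" "\<alpha> \<le> 1 / 2" "\<bar>real s - real n powr (1 - \<alpha>)\<bar> < 1"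
  shows "real n powr (1 - \<alpha>) / 2 \<le> real s" "real s \<le> 2 * real n powr (1 - \<alpha>)" "1 \<le> s" "s \<le> n"
proof -
  have N: "1 \<le> real n powr (1 - \<alpha>)" using assms by (intro ge_one_powr_ge_zero) auto
  then have "real s > 0" using assms by linarith
  then show s: "1 \<le> s" by simp
  then have "1 \<le> real s" by simp
  then show "real n powr (1 - \<alpha>) / 2 \<le> real s" "real s \<le> 2 * real n powr (1 - \<alpha>)"
    using assms N by linarith+
  have "real n powr (1 - \<alpha>) \<le> real n powr 1" using assms by (intro powr_mono) auto
  then have "real s < real n + 1" using assms by simp
  then show "s \<le> n" by linarith
qed

lemma Xi_nonempty:
  assumes "s \<le> n" "A > 0"
  shows "Xi n s A \<noteq> {}"
  using planted_in_Xi[of "{1..s}" n A] assms by auto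

lemma risk_nonneg:
  assumes "Xi n s A \<noteq> {}"
  shows "0 \<le> risk n lam (Xi n s A) T"
proof -
  obtain \<beta> where \<beta>: "\<beta> \<in> Xi n s A" using assms by blast
  have "bdd_above ((\<lambda>\<beta>. measure_pmf.prob (graph_law n lam \<beta>) {Y. \<not> T Y}) ` Xi n s A)"
    by (rule bdd_aboveI[of _ 1]) auto
  from cSUP_upper[OF \<beta> this]
  have "0 \<le> (SUP \<beta>\<in>Xi n s A. measure_pmf.prob (graph_law n lam \<beta>) {Y. \<not> T Y})"
    by (rule order_trans[OF measure_nonneg])
  then show ?thesis by (simp add: risk_def)
qed

text \<open>The integer \<open>s n\<close> may be any rounding of
  \<open>n powr (1 - \<alpha>)\<close>, up or down. The conditions on \<open>tanh (A n)\<close> are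
  imposed only for all large \<open>n\<close>, which includes the case where they hold for every
  \<open>n\<close>.\<close>

theorem theorem3p1:
  fixes \<alpha> r :: real and s :: "nat \<Rightarrow> nat" and lam A :: "nat \<Rightarrow> real"
  assumes "0 < \<alpha>" and "\<alpha> \<le> 1 / 2"
    and "\<And>n. n \<ge> 1 \<Longrightarrow> \<bar>real (s n) - real n powr (1 - \<alpha>)\<bar> < 1"
    and "\<And>n. n \<ge> 1 \<Longrightarrow> 1 \<le> lam n \<and> lam n \<le> real n"
    and "\<And>n. n \<ge> 1 \<Longrightarrow> A n > 0"
  shows
    "(r < C_dense \<alpha> \<and> (\<forall>\<^sub>F n in sequentially. tanh (A n) \<ge> real n powr (- r) / sqrt (lam n))
        \<longrightarrow> (\<exists>K. asymptotically_powerful lam (\<lambda>n. Xi n (s n) (A n))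
                   (\<lambda>n. total_degree_test n (lam n) (K n))))
   \<and> (r > C_dense \<alpha> \<and> (\<forall>\<^sub>F n in sequentially. tanh (A n) \<le> real n powr (- r) / sqrt (lam n))
        \<longrightarrow> (\<forall>T. asymptotically_powerless lam (\<lambda>n. Xi n (s n) (A n)) T))"
proof (intro conjI impI allI)
  assume asm: "r < C_dense \<alpha> \<and> (\<forall>\<^sub>F n in sequentially. tanh (A n) \<ge> real n powr (- r) / sqrt (lam n))"
  \<comment> \<open>Half of a lower bound for the shift \<open>lam * tanh A * s / 8\<close>,
    obtained from \<open>s \<ge> n powr (1 - \<alpha>) / 2\<close> and the assumption on
    \<open>tanh (A n)\<close>.\<close>
  define K where "K n = sqrt (lam n) * real n powr (1 - \<alpha> - r) / 32" for n
  \<comment> \<open>Twice the gap \<open>C_dense \<alpha> - r\<close>; the risk decays at least like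
    \<open>n powr (- d)\<close>, with constant \<open>8192 = 8 * 32 * 32\<close>.\<close>
  define d where "d = 1 - 2 * \<alpha> - 2 * r"
  have d: "d > 0" using asm by (simp add: d_def C_dense_def)
  let ?R = "\<lambda>n. risk n (lam n) (Xi n (s n) (A n)) (total_degree_test n (lam n) (K n))"
  have "\<forall>\<^sub>F n in sequentially. ?R n \<le> 8192 * real n powr (- d)"
    using conjunct2[OF asm] eventually_ge_at_top[of 2]
  proof eventually_elim
    case (elim n)
    then have n: "n \<ge> 1" by simp
    note lam = assms(4)[OF n] and A = assms(5)[OF n]
    note s = sparsity_bounds[OF n assms(1,2) assms(3)[OF n]]
    have sq: "sqrt (lam n) > 0" "sqrt (lam n) * sqrt (lam n) = lam n" using lam by auto
    have K: "K n > 0" using n sq by (simp add: K_def)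
    have "2 * K n = sqrt (lam n) * real n powr (- r) * (real n powr (1 - \<alpha>) / 2) / 8"
      by (simp add: K_def powr_add[symmetric])
    also have "\<dots> \<le> sqrt (lam n) * (sqrt (lam n) * tanh (A n)) * real (s n) / 8"
    proof (intro divide_right_mono mult_mono s(1) mult_left_mono)
      show "real n powr (- r) \<le> sqrt (lam n) * tanh (A n)"
        using elim(1) sq(1) by (simp add: divide_le_eq mult.commute)
    qed (use sq A in auto)
    also have "\<dots> = lam n * tanh (A n) * real (s n) / 8"
      using sq(2) by (metis mult.assoc)
    finally have "?R n \<le> 8 * real n * lam n / (K n)\<^sup>2"
      using elim(2) lam A K s(4) by (intro risk_total_degree_test_le Xi_nonempty) auto
    also have "(K n)\<^sup>2 = lam n * real n powr (1 + d) / 1024"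
    proof -
      have "(real n powr (1 - \<alpha> - r))\<^sup>2 = real n powr (1 + d)"
        by (simp add: power2_eq_square powr_add[symmetric] d_def)
      then show ?thesis using lam by (simp add: K_def power_divide power_mult_distrib)
    qed
    also have "8 * real n * lam n / (lam n * real n powr (1 + d) / 1024) = 8192 * real n powr (- d)"
      using n lam by (simp add: powr_add powr_minus field_simps)
    finally show ?case .
  qed
  moreover have "\<forall>\<^sub>F n in sequentially. 0 \<le> ?R n"
    using eventually_ge_at_top[of 1]
  proof eventually_elim
    case (elim n)
    show ?case
      by (intro risk_nonneg Xi_nonempty sparsity_bounds(4)[OF elim assms(1,2) assms(3)[OF elim]] assms(5) elim)
  qed
  ultimately have "?R \<longlonglongrightarrow> 0"
    by (intro tendsto_sandwich[OF _ _ tendsto_const powr_limit_0[OF d]])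
  then have "(\<lambda>n. ereal (?R n)) \<longlonglongrightarrow> 0"
    by (simp add: zero_ereal_def)
  then have "asymptotically_powerful lam (\<lambda>n. Xi n (s n) (A n)) (\<lambda>n. total_degree_test n (lam n) (K n))"
    unfolding asymptotically_powerful_def by (intro lim_imp_Limsup) auto
  then show "\<exists>K. asymptotically_powerful lam (\<lambda>n. Xi n (s n) (A n)) (\<lambda>n. total_degree_test n (lam n) (K n))"
    by blast
next
  fix T
  assume asm: "r > C_dense \<alpha> \<and> (\<forall>\<^sub>F n in sequentially. tanh (A n) \<le> real n powr (- r) / sqrt (lam n))"
  \<comment> \<open>Twice the gap \<open>r - C_dense \<alpha>\<close>, so that
    \<open>\<theta> * (s n)\<^sup>2 / n\<close> is at most \<open>4 * n powr (- d)\<close>.\<close>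
  define d where "d = 2 * r - 1 + 2 * \<alpha>"
  \<comment> \<open>Positivity of \<open>r\<close> follows from \<open>\<alpha> \<le> 1 / 2\<close>
    and yields \<open>\<theta> \<le> 1\<close> below.\<close>
  have d: "d > 0" and r: "r > 0" using asm assms(2) by (auto simp: d_def C_dense_def)
  let ?R = "\<lambda>n. risk n (lam n) (Xi n (s n) (A n)) (T n)"
  \<comment> \<open>The constant 20 is the 5 of \<open>risk_ge\<close> times the square of the
    factor 2 in \<open>sparsity_bounds\<close>.\<close>
  let ?b = "\<lambda>n. 1 - sqrt (exp (20 * real n powr (- d)) - 1)"
  have le: "\<forall>\<^sub>F n in sequentially. ?b n \<le> ?R n"
    using conjunct2[OF asm] eventually_ge_at_top[of 1]
  proof eventually_elim
    case (elim n)
    note n = elim(2)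
    note lam = assms(4)[OF n] and A = assms(5)[OF n]
    note s = sparsity_bounds[OF n assms(1,2) assms(3)[OF n]]
    define \<theta> where "\<theta> = real n powr (- 2 * r)"
    have sq: "sqrt (lam n) > 0" using lam by auto
    have "sqrt (lam n) * tanh (A n) \<le> real n powr (- r)"
      using elim(1) sq by (simp add: le_divide_eq mult.commute)
    then have "(sqrt (lam n) * tanh (A n))\<^sup>2 \<le> (real n powr (- r))\<^sup>2"
      using sq A by (intro power_mono) auto
    then have "lam n * (tanh (A n))\<^sup>2 \<le> \<theta>"
      using lam by (simp add: power_mult_distrib \<theta>_def power2_eq_square[of "real n powr _"] powr_add[symmetric])
    moreover have "\<theta> \<le> 1"
      using powr_mono[of "- 2 * r" 0 "real n"] n r by (simp add: \<theta>_def)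
    ultimately have "1 - sqrt (exp (5 * \<theta> * (real (s n))\<^sup>2 / n) - 1) \<le> ?R n"
      using s lam A by (intro risk_ge) auto
    moreover have "5 * \<theta> * (real (s n))\<^sup>2 / n \<le> 20 * real n powr (- d)"
    proof -
      have "5 * \<theta> * (real (s n))\<^sup>2 / n \<le> 5 * \<theta> * (2 * real n powr (1 - \<alpha>))\<^sup>2 / n"
        using s(2) by (intro divide_right_mono mult_left_mono power_mono) (auto simp: \<theta>_def)
      also have "\<dots> = 20 * (real n powr (- 2 * r) * (real n powr (1 - \<alpha>) * real n powr (1 - \<alpha>)) * real n powr (- 1))"
        using n by (simp add: \<theta>_def power2_eq_square powr_minus field_simps)
      also have "\<dots> = 20 * real n powr (- d)"
        by (simp only: powr_add[symmetric]) (simp add: d_def algebra_simps)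
      finally show ?thesis .
    qed
    ultimately show ?case
      by (smt (verit) exp_le_cancel_iff real_sqrt_le_iff)
  qed
  have "?b \<longlonglongrightarrow> 1 - sqrt (exp 0 - 1)"
    by (intro tendsto_intros powr_limit_0 d)
  then have "(\<lambda>n. ereal (?b n)) \<longlonglongrightarrow> 1"
    by (simp add: one_ereal_def)
  then have "1 = liminf (\<lambda>n. ereal (?b n))"
    by (intro lim_imp_Liminf[symmetric]) auto
  also have "\<dots> \<le> liminf (\<lambda>n. ereal (?R n))"
    using le by (intro Liminf_mono) (auto elim: eventually_mono)
  finally show "asymptotically_powerless lam (\<lambda>n. Xi n (s n) (A n)) T"
    unfolding asymptotically_powerless_def .
qed

end
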